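(* Let $n\ge1$, let $F\colon M\to N$ be a smooth map of manifolds and $\varpi\in\Omega^{n+1}(F)$ a $d_F$-closed relative form. Let $\sigma\in\Omega^{n-1}(F)$ be a relative Hamiltonian with Hamiltonian $F$-pair $v_\sigma$, i.e. $d_F\sigma=-\iota_{v_\sigma}\varpi$. Let $v_x$ be an $F$-pair with $\mathcal L_{v_x}\varpi=0$, admitting a Hamiltonian $f_1(x)\in\Omega^{n-1}(F)$, i.e. $d_Ff_1(x)=-\iota_{v_x}\varpi$, and preserving the dynamics: $\mathcal L_{v_x}\sigma=0$. Then $$\mathcal L_{v_\sigma}f_1(x)=d_F\bigl(\iota_{v_\sigma}f_1(x)+\iota_{v_x}\sigma\bigr).$$ In particular $f_1(x)$ is conserved along the dynamics up to an explicit $d_F$-exact term. Symmetrically, $\sigma$ is conserved along $v_x$ up to $d_F$-exact terms (i.e. $\mathcal L_{v_x}\sigma$ is $d_F$-exact).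
   Context: $\Omega^k(F)=\Omega^k(N)\oplus\Omega^{k-1}(M)$ with $d_F(\alpha,\beta)=(d\alpha,F^*\alpha-d\beta)$. An $F$-pair is $v=(v_N,v_M)$ with $v_N\in\mathfrak X(N)$, $v_M\in\mathfrak X(M)$ that are $F$-related: $dF\circ v_M=v_N\circ F$. Relative contraction and Lie derivative: $\iota_v(\alpha,\beta)=(\iota_{v_N}\alpha,-\iota_{v_M}\beta)$, $\mathcal L_v(\alpha,\beta)=(\mathcal L_{v_N}\alpha,\mathcal L_{v_M}\beta)$. *)

theory Defs
  imports "HOL-Analysis.Analysis" "HOL-Library.Function_Algebras"
begin

section \<open>Smooth maps on open subsets of a finite-dimensional normed space\<close>

text \<open>
  Derivatives in fixed directions are iterated; on an open set of a
  finite-dimensional space this is the usual class of k times continuously differentiable maps.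
\<close>

primrec Ck_on :: "nat \<Rightarrow> 'e::real_normed_vector set \<Rightarrow> ('e \<Rightarrow> 'f::real_normed_vector) \<Rightarrow> bool" where
  "Ck_on 0 S f \<longleftrightarrow> continuous_on S f"
| "Ck_on (Suc k) S f \<longleftrightarrow> (\<forall>x\<in>S. f differentiable (at x)) \<and>
     (\<forall>u. Ck_on k S (\<lambda>x. frechet_derivative f (at x) u))"

definition smooth_on :: "'e::real_normed_vector set \<Rightarrow> ('e \<Rightarrow> 'f::real_normed_vector) \<Rightarrow> bool" where
  "smooth_on S f \<longleftrightarrow> (\<forall>k. Ck_on k S f)"


section \<open>Smooth manifolds and smooth maps\<close>

text \<open>
  A manifold is modelled on a finite-dimensional real normed space \<open>'e\<close>. The class
  \<open>euclidean_space\<close> is avoided because its members have dimension at least 1, which would exclude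
  0-dimensional manifolds. The smooth structure is given by a smooth atlas, which need not be
  maximal. A chart is a domain together with a coordinate map; the values of the coordinate map
  outside the domain are irrelevant.
\<close>

type_synonym ('a, 'e) chart = "'a set \<times> ('a \<Rightarrow> 'e)"

record ('a, 'e) manifold =
  mtop :: "'a topology"
  atlas :: "('a, 'e) chart set"

definition chart_image :: "('a, 'e) chart \<Rightarrow> 'e set" where
  "chart_image c = snd c ` fst c"

definition chart_inv :: "('a, 'e) chart \<Rightarrow> 'e \<Rightarrow> 'a" where
  "chart_inv c = inv_into (fst c) (snd c)"

definition local_rep :: "('a \<Rightarrow> 'b) \<Rightarrow> ('a, 'e) chart \<Rightarrow> ('b, 'f) chart \<Rightarrow> 'e \<Rightarrow> 'f" where
  "local_rep F c c' = snd c' \<circ> F \<circ> chart_inv c"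

definition local_dom :: "('a \<Rightarrow> 'b) \<Rightarrow> ('a, 'e) chart \<Rightarrow> ('b, 'f) chart \<Rightarrow> 'e set" where
  "local_dom F c c' = snd c ` {p \<in> fst c. F p \<in> fst c'}"

text \<open>In particular \<open>local_rep id c c'\<close> is the transition map from \<open>c\<close> to \<open>c'\<close>, defined on
  \<open>local_dom id c c'\<close>.\<close>

definition smooth_manifold :: "('a, 'e::real_normed_vector) manifold \<Rightarrow> bool" where
  "smooth_manifold M \<longleftrightarrow>
     (\<exists>B. finite B \<and> span B = (UNIV :: 'e set)) \<and>
     Hausdorff_space (mtop M) \<and> second_countable (mtop M) \<and>
     (\<Union>c\<in>atlas M. fst c) = topspace (mtop M) \<and>
     (\<forall>c\<in>atlas M. openin (mtop M) (fst c) \<and> open (chart_image c) \<and>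
        homeomorphic_map (subtopology (mtop M) (fst c)) (top_of_set (chart_image c)) (snd c)) \<and>
     (\<forall>c\<in>atlas M. \<forall>c'\<in>atlas M. smooth_on (local_dom id c c') (local_rep id c c'))"

definition smooth_map ::
  "('a, 'e::real_normed_vector) manifold \<Rightarrow> ('b, 'f::real_normed_vector) manifold \<Rightarrow> ('a \<Rightarrow> 'b) \<Rightarrow> bool" where
  "smooth_map M N F \<longleftrightarrow> continuous_map (mtop M) (mtop N) F \<and>
     (\<forall>c\<in>atlas M. \<forall>c'\<in>atlas N. smooth_on (local_dom F c c') (local_rep F c c'))"


section \<open>Vector fields and differential forms\<close>

text \<open>
  Vector fields and differential forms are families of coordinate representatives, one for each
  chart of the atlas and defined on the image of the chart, which are matched by the transition
  maps. A representative of a form takes a point of the chart image and a list of vectors of the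
  model space. All representatives are extended by 0, so that equality of families is equality of
  vector fields and of forms. The degree is an integer: there are no lists of negative length, so
  in negative degrees only the zero form remains.
\<close>

type_synonym ('a, 'e) vector_field = "('a, 'e) chart \<Rightarrow> 'e \<Rightarrow> 'e"
type_synonym ('a, 'e) form = "('a, 'e) chart \<Rightarrow> 'e \<Rightarrow> 'e list \<Rightarrow> real"

definition vector_fields :: "('a, 'e::real_normed_vector) manifold \<Rightarrow> ('a, 'e) vector_field set" where
  "vector_fields M = {v.
     (\<forall>c x. v c x \<noteq> 0 \<longrightarrow> c \<in> atlas M \<and> x \<in> chart_image c) \<and>
     (\<forall>c\<in>atlas M. smooth_on (chart_image c) (v c)) \<and>
     (\<forall>c\<in>atlas M. \<forall>c'\<in>atlas M. \<forall>x\<in>local_dom id c c'.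
        v c' (local_rep id c c' x) = frechet_derivative (local_rep id c c') (at x) (v c x))}"

definition alternating_multilinear :: "('e::real_vector list \<Rightarrow> real) \<Rightarrow> bool" where
  "alternating_multilinear f \<longleftrightarrow>
     (\<forall>vs. \<forall>i<length vs. linear (\<lambda>u. f (vs[i := u]))) \<and>
     (\<forall>vs. \<forall>j<length vs. \<forall>i<j. vs ! i = vs ! j \<longrightarrow> f vs = 0)"

definition local_pullback ::
  "('e::real_normed_vector \<Rightarrow> 'f::real_normed_vector) \<Rightarrow> ('f \<Rightarrow> 'f list \<Rightarrow> real) \<Rightarrow> 'e \<Rightarrow> 'e list \<Rightarrow> real" where
  "local_pullback \<tau> \<omega> x vs = \<omega> (\<tau> x) (map (frechet_derivative \<tau> (at x)) vs)"

definition forms :: "('a, 'e::real_normed_vector) manifold \<Rightarrow> int \<Rightarrow> ('a, 'e) form set" where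
  "forms M k = {\<omega>.
     (\<forall>c x vs. \<omega> c x vs \<noteq> 0 \<longrightarrow> c \<in> atlas M \<and> x \<in> chart_image c \<and> int (length vs) = k) \<and>
     (\<forall>c\<in>atlas M. \<forall>x\<in>chart_image c. alternating_multilinear (\<omega> c x)) \<and>
     (\<forall>c\<in>atlas M. \<forall>vs. smooth_on (chart_image c) (\<lambda>x. \<omega> c x vs)) \<and>
     (\<forall>c\<in>atlas M. \<forall>c'\<in>atlas M. \<forall>x\<in>local_dom id c c'.
        \<omega> c x = local_pullback (local_rep id c c') (\<omega> c') x)}"

text \<open>
  Exterior derivative: in a chart,
  \<open>(d\<omega>)\<^sub>x(v\<^sub>0,\<dots>,v\<^sub>k) = \<Sum>i. (-1)\<^sup>i (D\<omega>\<^sub>x \<cdot> v\<^sub>i)(v\<^sub>0,\<dots>,v\<^sub>k without v\<^sub>i)\<close>.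
\<close>

definition ext_deriv :: "('a, 'e::real_normed_vector) manifold \<Rightarrow> ('a, 'e) form \<Rightarrow> ('a, 'e) form" where
  "ext_deriv M \<omega> c x vs =
     (if c \<in> atlas M \<and> x \<in> chart_image c
      then \<Sum>i<length vs. (-1) ^ i *
             frechet_derivative (\<lambda>y. \<omega> c y (take i vs @ drop (Suc i) vs)) (at x) (vs ! i)
      else 0)"

definition contraction :: "('a, 'e) vector_field \<Rightarrow> ('a, 'e) form \<Rightarrow> ('a, 'e) form" where
  "contraction v \<omega> c x vs = \<omega> c x (v c x # vs)"

text \<open>
  Lie derivative: \<open>(L\<^sub>v\<omega>)(w\<^sub>1,\<dots>,w\<^sub>k) = v(\<omega>(w\<^sub>1,\<dots>,w\<^sub>k)) - \<Sum>i. \<omega>(w\<^sub>1,\<dots>,[v,w\<^sub>i],\<dots>,w\<^sub>k)\<close>, evaluated on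
  constant coordinate fields, for which \<open>[v,w\<^sub>i] = - Dv \<cdot> w\<^sub>i\<close>.
\<close>

definition lie_deriv ::
  "('a, 'e::real_normed_vector) manifold \<Rightarrow> ('a, 'e) vector_field \<Rightarrow> ('a, 'e) form \<Rightarrow> ('a, 'e) form" where
  "lie_deriv M v \<omega> c x ws =
     (if c \<in> atlas M \<and> x \<in> chart_image c
      then frechet_derivative (\<lambda>y. \<omega> c y ws) (at x) (v c x) +
           (\<Sum>i<length ws. \<omega> c x (ws[i := frechet_derivative (v c) (at x) (ws ! i)]))
      else 0)"

text \<open>The pullback does not depend on the chosen chart around the image point, because the
  representatives of a form are matched by the transition maps.\<close>

definition pullback ::
  "('a, 'e::real_normed_vector) manifold \<Rightarrow> ('b, 'f::real_normed_vector) manifold \<Rightarrow> ('a \<Rightarrow> 'b) \<Rightarrow>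
   ('b, 'f) form \<Rightarrow> ('a, 'e) form" where
  "pullback M N F \<alpha> c x vs =
     (if c \<in> atlas M \<and> x \<in> chart_image c
      then let c' = (SOME c'. c' \<in> atlas N \<and> F (chart_inv c x) \<in> fst c')
           in local_pullback (local_rep F c c') (\<alpha> c') x vs
      else 0)"


section \<open>Relative forms of a smooth map\<close>

text \<open>Forms are added and negated pointwise, and relative forms componentwise, through the
  group structures on functions and on pairs.\<close>

type_synonym ('a, 'e, 'b, 'f) rel_form = "('b, 'f) form \<times> ('a, 'e) form"
type_synonym ('a, 'e, 'b, 'f) vf_pair = "('b, 'f) vector_field \<times> ('a, 'e) vector_field"

definition rel_forms ::
  "('a, 'e::real_normed_vector) manifold \<Rightarrow> ('b, 'f::real_normed_vector) manifold \<Rightarrow> int \<Rightarrow>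
   ('a, 'e, 'b, 'f) rel_form set" where
  "rel_forms M N k = forms N k \<times> forms M (k - 1)"

definition rel_d ::
  "('a, 'e::real_normed_vector) manifold \<Rightarrow> ('b, 'f::real_normed_vector) manifold \<Rightarrow> ('a \<Rightarrow> 'b) \<Rightarrow>
   ('a, 'e, 'b, 'f) rel_form \<Rightarrow> ('a, 'e, 'b, 'f) rel_form" where
  "rel_d M N F \<equiv> \<lambda>(\<alpha>, \<beta>). (ext_deriv N \<alpha>, pullback M N F \<alpha> - ext_deriv M \<beta>)"

definition F_pair ::
  "('a, 'e::real_normed_vector) manifold \<Rightarrow> ('b, 'f::real_normed_vector) manifold \<Rightarrow> ('a \<Rightarrow> 'b) \<Rightarrow>
   ('a, 'e, 'b, 'f) vf_pair \<Rightarrow> bool" where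
  "F_pair M N F \<equiv> \<lambda>(v\<^sub>N, v\<^sub>M). v\<^sub>N \<in> vector_fields N \<and> v\<^sub>M \<in> vector_fields M \<and>
     (\<forall>c\<in>atlas M. \<forall>c'\<in>atlas N. \<forall>x\<in>local_dom F c c'.
        frechet_derivative (local_rep F c c') (at x) (v\<^sub>M c x) = v\<^sub>N c' (local_rep F c c' x))"

definition rel_contraction ::
  "('a, 'e, 'b, 'f) vf_pair \<Rightarrow> ('a, 'e, 'b, 'f) rel_form \<Rightarrow> ('a, 'e, 'b, 'f) rel_form" where
  "rel_contraction \<equiv> \<lambda>(v\<^sub>N, v\<^sub>M) (\<alpha>, \<beta>). (contraction v\<^sub>N \<alpha>, - contraction v\<^sub>M \<beta>)"

definition rel_lie ::
  "('a, 'e::real_normed_vector) manifold \<Rightarrow> ('b, 'f::real_normed_vector) manifold \<Rightarrow>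
   ('a, 'e, 'b, 'f) vf_pair \<Rightarrow> ('a, 'e, 'b, 'f) rel_form \<Rightarrow> ('a, 'e, 'b, 'f) rel_form" where
  "rel_lie M N \<equiv> \<lambda>(v\<^sub>N, v\<^sub>M) (\<alpha>, \<beta>). (lie_deriv N v\<^sub>N \<alpha>, lie_deriv M v\<^sub>M \<beta>)"

definition rel_exact ::
  "('a, 'e::real_normed_vector) manifold \<Rightarrow> ('b, 'f::real_normed_vector) manifold \<Rightarrow> ('a \<Rightarrow> 'b) \<Rightarrow> int \<Rightarrow>
   ('a, 'e, 'b, 'f) rel_form \<Rightarrow> bool" where
  "rel_exact M N F k \<eta> \<longleftrightarrow> (\<exists>\<theta>\<in>rel_forms M N (k - 1). \<eta> = rel_d M N F \<theta>)"

end

theory Submission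
  imports Defs
begin

text \<open>
  Write \<open>d\<close> for the relative differential. The relative operators
  satisfy Cartan's formula \<open>L\<^sub>v = d \<iota>\<^sub>v + \<iota>\<^sub>v d\<close> (\<open>rel_lie_cartan\<close>), and relative contractions
  anticommute (\<open>rel_contraction_rel_contraction\<close>). With \<open>v = v\<^sub>\<sigma>\<close>, \<open>w = v\<^sub>x\<close> and \<open>f = f\<^sub>1x\<close>, the
  Hamilton equations give
  \<open>\<iota>\<^sub>v d f = - \<iota>\<^sub>v \<iota>\<^sub>w \<omega> = \<iota>\<^sub>w \<iota>\<^sub>v \<omega> = - \<iota>\<^sub>w d \<sigma> = d \<iota>\<^sub>w \<sigma> - L\<^sub>w \<sigma> = d \<iota>\<^sub>w \<sigma>\<close>,
  hence \<open>L\<^sub>v f = d \<iota>\<^sub>v f + \<iota>\<^sub>v d f = d (\<iota>\<^sub>v f + \<iota>\<^sub>w \<sigma>)\<close>. Exactness of \<open>L\<^sub>w \<sigma>\<close> is immediate, as it vanishes.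

  The relative Cartan formula follows from the absolute one on both manifolds (\<open>lie_deriv_cartan\<close>) and
  from the compatibility of pullback with contraction by \<open>F\<close>-related fields (\<open>pullback_contraction\<close>).
  The absolute formula is a computation in a chart, resting on a product rule for
  \<open>y \<mapsto> \<omega>\<^sub>y(v y, \<dots>)\<close>. Forms are smooth for each fixed list of vectors, so this rule, and the smoothness
  of a contraction, is obtained by expanding \<open>v\<close> in coordinates
  (\<open>smooth_on_linear_apply\<close>, \<open>frechet_derivative_linear_apply\<close>). Continuity of the coordinates is
  proved for a normed space with a finite spanning set (\<open>finite_dim_coordinates\<close>).
\<close>

section \<open>Coordinates on a finite-dimensional normed space\<close>

text \<open>
  The bound behind both completeness and continuity of coordinates: modulo \<open>span S\<close> only
  the multiple of \<open>b\<close> matters, and \<open>infdist b (span S)\<close> is the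
  quotient seminorm of \<open>b\<close>.
\<close>

lemma coefficient_bound:
  fixes b :: "'e::real_normed_vector"
  assumes "s \<in> span S"
  shows "\<bar>a\<bar> * infdist b (span S) \<le> norm (a *\<^sub>R b + s)"
proof (cases "a = 0")
  case False
  have "- ((1/a) *\<^sub>R s) \<in> span S" using assms by (simp add: span_neg span_scale)
  then have "infdist b (span S) \<le> dist b (- ((1/a) *\<^sub>R s))" by (rule infdist_le)
  also have "\<dots> = norm (b + (1/a) *\<^sub>R s)" by (simp add: dist_norm)
  finally have "\<bar>a\<bar> * infdist b (span S) \<le> \<bar>a\<bar> * norm (b + (1/a) *\<^sub>R s)"
    by (simp add: mult_left_mono)
  also have "\<dots> = norm (a *\<^sub>R (b + (1/a) *\<^sub>R s))" by simp
  also have "a *\<^sub>R (b + (1/a) *\<^sub>R s) = a *\<^sub>R b + s" using False by (simp add: scaleR_add_right)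
  finally show ?thesis .
qed simp

text \<open>
  By induction on \<open>B\<close>. If the new vector \<open>b\<close> lies outside \<open>span B\<close>, then \<open>span B\<close> is closed because it
  is complete, so \<open>b\<close> has positive distance from it; by the coefficient bound, the multiple of \<open>b\<close>
  in a Cauchy sequence is itself a Cauchy sequence, and hence so is the part in \<open>span B\<close>.
\<close>

lemma complete_span_finite:
  fixes B :: "'e::real_normed_vector set"
  assumes "finite B"
  shows "complete (span B)"
  using assms
proof (induction B rule: finite_induct)
  case empty
  then show ?case by (simp add: compact_imp_complete)
next
  case (insert b B)
  show ?case
  proof (cases "b \<in> span B")
    case True
    then show ?thesis using insert.IH by (simp add: span_redundant)
  next
    case False
    have cl: "closed (span B)" using insert.IH by (rule complete_imp_closed)
    have ne: "span B \<noteq> {}" using span_zero by blast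
    define d where "d = infdist b (span B)"
    have d: "d > 0" unfolding d_def using False cl ne
      using infdist_pos_not_in_closed by blast
    show ?thesis unfolding complete_def
    proof (intro allI impI, elim conjE)
      fix f :: "nat \<Rightarrow> 'e" assume f: "\<forall>n. f n \<in> span (insert b B)" and cau: "Cauchy f"
      have "\<forall>n. \<exists>k. f n - k *\<^sub>R b \<in> span B" using f by (simp add: span_insert)
      then obtain a where a: "\<And>n. f n - a n *\<^sub>R b \<in> span B" by metis
      define s where "s n = f n - a n *\<^sub>R b" for n
      have lip: "\<bar>a m - a n\<bar> * d \<le> norm (f m - f n)" for m n
      proof -
        have "\<bar>a m - a n\<bar> * d \<le> norm ((a m - a n) *\<^sub>R b + (s m - s n))"
          unfolding d_def by (rule coefficient_bound) (simp add: s_def a span_diff)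
        then show ?thesis by (simp add: s_def algebra_simps)
      qed
      have "Cauchy a"
      proof (rule metric_CauchyI)
        fix e :: real assume "e > 0"
        then have "e * d > 0" using d by simp
        then obtain K where K: "\<forall>m\<ge>K. \<forall>n\<ge>K. dist (f m) (f n) < e * d"
          using cau unfolding Cauchy_def by blast
        have "dist (a m) (a n) < e" if "m \<ge> K" "n \<ge> K" for m n
        proof -
          have "\<bar>a m - a n\<bar> * d < e * d" using lip[of m n] K that by (force simp: dist_norm)
          then show ?thesis using d by (simp add: dist_real_def)
        qed
        then show "\<exists>K. \<forall>m\<ge>K. \<forall>n\<ge>K. dist (a m) (a n) < e" by blast
      qed
      then obtain l where l: "a \<longlonglongrightarrow> l" using Cauchy_convergent_iff convergent_def by blast
      have ab: "(\<lambda>n. a n *\<^sub>R b) \<longlonglongrightarrow> l *\<^sub>R b" using l by (intro tendsto_intros)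
      have "Cauchy s"
      proof (rule metric_CauchyI)
        fix e :: real assume e: "e > 0"
        obtain K where K: "\<And>m n. m \<ge> K \<Longrightarrow> n \<ge> K \<Longrightarrow> dist (f m) (f n) < e / 2"
          using metric_CauchyD[OF cau, of "e / 2"] e by auto
        obtain L where L: "\<And>m n. m \<ge> L \<Longrightarrow> n \<ge> L \<Longrightarrow> dist (a m *\<^sub>R b) (a n *\<^sub>R b) < e / 2"
          using metric_CauchyD[OF ab[THEN LIMSEQ_imp_Cauchy], of "e / 2"] e by auto
        have "dist (s m) (s n) < e" if "m \<ge> max K L" "n \<ge> max K L" for m n
          using dist_triangle_add[of "f m" "- (a m *\<^sub>R b)" "f n" "- (a n *\<^sub>R b)"]
            K[of m n] L[of m n] that by (simp add: s_def dist_minus)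
        then show "\<exists>K. \<forall>m\<ge>K. \<forall>n\<ge>K. dist (s m) (s n) < e" by blast
      qed
      moreover have "s n \<in> span B" for n unfolding s_def by (rule a)
      ultimately obtain t where t: "t \<in> span B" "s \<longlonglongrightarrow> t"
        using completeE[OF insert.IH] by metis
      have "(\<lambda>n. s n + a n *\<^sub>R b) \<longlonglongrightarrow> t + l *\<^sub>R b" using t(2) ab by (rule tendsto_add)
      moreover have "(\<lambda>n. s n + a n *\<^sub>R b) = f" by (simp add: s_def)
      moreover have "t + l *\<^sub>R b \<in> span (insert b B)"
        using t(1) by (auto simp: span_insert intro!: exI[of _ l])
      ultimately show "\<exists>l\<in>span (insert b B). f \<longlonglongrightarrow> l" by auto
    qed
  qed
qed

text \<open>
  The model spaces of manifolds are only normed spaces with a finite spanning set, so the continuity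
  of coordinate functionals has to be derived: the coefficient bound applies to each basis vector
  and the (closed) span of the other ones.
\<close>

lemma finite_dim_coordinates:
  fixes B :: "'e::real_normed_vector set"
  assumes "finite B" and "span B = UNIV"
  obtains C and coord :: "'e \<Rightarrow> 'e \<Rightarrow> real"
  where "finite C" and "\<And>b. b \<in> C \<Longrightarrow> bounded_linear (coord b)"
    and "\<And>x. x = (\<Sum>b\<in>C. coord b x *\<^sub>R b)"
proof -
  obtain C where C: "C \<subseteq> B" "independent C" "B \<subseteq> span C"
    by (rule maximal_independent_subset)
  have fin: "finite C" using C(1) assms(1) finite_subset by blast
  have sp: "x \<in> span C" for x
    using C(3) assms(2) span_mono[of B "span C"] by (auto simp: span_span)
  let ?r = "\<lambda>b x. representation C x b"
  have sum: "x = (\<Sum>b\<in>C. ?r b x *\<^sub>R b)" for x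
    using real_vector.sum_representation_eq[OF C(2) sp fin order_refl] by simp
  have "bounded_linear (?r b)" if b: "b \<in> C" for b
  proof -
    let ?S = "span (C - {b})"
    have ne: "?S \<noteq> {}" using span_zero by blast
    have cl: "closed ?S" using fin by (simp add: complete_imp_closed complete_span_finite)
    have nin: "b \<notin> ?S" using b C(2) dependent_def by blast
    define d where "d = infdist b ?S"
    have d: "d > 0" unfolding d_def using nin cl ne infdist_pos_not_in_closed by blast
    have bound: "norm (?r b x) \<le> norm x * (1 / d)" for x
    proof -
      define s where "s = (\<Sum>c\<in>C - {b}. ?r c x *\<^sub>R c)"
      have s: "s \<in> ?S" unfolding s_def by (intro span_sum span_scale span_base)
      have "x = ?r b x *\<^sub>R b + s"
        using sum[of x] fin b by (simp add: s_def sum.remove)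
      then have "\<bar>?r b x\<bar> * d \<le> norm x"
        using coefficient_bound[OF s, of "?r b x" b] by (simp add: d_def)
      then show ?thesis using d by (simp add: field_simps)
    qed
    show ?thesis
      by (rule bounded_linear_intro[OF _ _ bound])
        (simp_all add: real_vector.representation_add[OF C(2) sp sp]
          real_vector.representation_scale[OF C(2) sp])
  qed
  then show ?thesis using that[OF fin _ sum] by blast
qed

section \<open>Calculus of smooth maps\<close>

lemma has_derivative_frechet_derivative:
  "f differentiable (at x) \<Longrightarrow> (f has_derivative frechet_derivative f (at x)) (at x)"
  by (simp add: frechet_derivative_works)

lemma frechet_derivative_cong_open:
  assumes "open S" "x \<in> S" "\<And>y. y \<in> S \<Longrightarrow> f y = g y"
  shows "frechet_derivative f (at x) = frechet_derivative g (at x)"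
proof -
  have "(f has_derivative f') (at x) \<longleftrightarrow> (g has_derivative f') (at x)" for f'
    using assms by (metis has_derivative_transform_within_open)
  then show ?thesis by (simp add: frechet_derivative_def)
qed

lemma Ck_on_cong:
  assumes "open S" "\<And>y. y \<in> S \<Longrightarrow> f y = g y" "Ck_on k S f"
  shows "Ck_on k S g"
  using assms(2,3)
proof (induction k arbitrary: f g)
  case 0
  then show ?case by (metis Ck_on.simps(1) continuous_on_cong)
next
  case (Suc k)
  have "g differentiable (at x)" if "x \<in> S" for x
    using Suc.prems that assms(1) has_derivative_transform_within_open
    unfolding differentiable_def Ck_on.simps by metis
  moreover have "Ck_on k S (\<lambda>x. frechet_derivative g (at x) u)" for u
    by (rule Suc.IH[of "\<lambda>x. frechet_derivative f (at x) u"])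
      (use Suc.prems frechet_derivative_cong_open[OF assms(1), of _ f g] in auto)
  ultimately show ?case by simp
qed

lemma Ck_on_Suc_imp: "Ck_on (Suc k) S f \<Longrightarrow> Ck_on k S f"
proof (induction k arbitrary: f)
  case 0
  then show ?case
    by (simp add: continuous_at_imp_continuous_on differentiable_imp_continuous_within)
next
  case (Suc k)
  then show ?case by (metis Ck_on.simps(2))
qed

lemma Ck_on_const: "Ck_on k S (\<lambda>x. c)"
  by (induction k arbitrary: c) simp_all

lemma Ck_on_add:
  assumes "open S" "Ck_on k S f" "Ck_on k S g"
  shows "Ck_on k S (\<lambda>x. f x + g x)"
  using assms(2,3)
proof (induction k arbitrary: f g)
  case 0
  then show ?case by (simp add: continuous_on_add)
next
  case (Suc k)
  have der: "frechet_derivative (\<lambda>x. f x + g x) (at x) u =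
      frechet_derivative f (at x) u + frechet_derivative g (at x) u" if "x \<in> S" for x u
    using Suc.prems that
    by (simp flip: frechet_derivative_at[OF has_derivative_add[OF
          has_derivative_frechet_derivative has_derivative_frechet_derivative]])
  have "Ck_on k S (\<lambda>x. frechet_derivative (\<lambda>x. f x + g x) (at x) u)" for u
    by (rule Ck_on_cong[OF assms(1) _ Suc.IH[of "\<lambda>x. frechet_derivative f (at x) u"
            "\<lambda>x. frechet_derivative g (at x) u"]])
      (use Suc.prems der in auto)
  then show ?case using Suc.prems by simp
qed

lemma Ck_on_scaleR:
  fixes f :: "'e::real_normed_vector \<Rightarrow> real"
  assumes "open S" "Ck_on k S f" "Ck_on k S g"
  shows "Ck_on k S (\<lambda>x. f x *\<^sub>R g x)"
  using assms(2,3)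
proof (induction k arbitrary: f g)
  case 0
  then show ?case by (simp add: continuous_on_scaleR)
next
  case (Suc k)
  have der: "frechet_derivative (\<lambda>x. f x *\<^sub>R g x) (at x) u =
      f x *\<^sub>R frechet_derivative g (at x) u + frechet_derivative f (at x) u *\<^sub>R g x" if "x \<in> S" for x u
    using Suc.prems that
    by (simp flip: frechet_derivative_at[OF has_derivative_scaleR[OF
          has_derivative_frechet_derivative has_derivative_frechet_derivative]])
  have "Ck_on k S (\<lambda>x. f x *\<^sub>R frechet_derivative g (at x) u + frechet_derivative f (at x) u *\<^sub>R g x)" for u
    using Suc.prems by (intro Ck_on_add Suc.IH assms(1)) (auto intro: Ck_on_Suc_imp)
  then have "Ck_on k S (\<lambda>x. frechet_derivative (\<lambda>x. f x *\<^sub>R g x) (at x) u)" for u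
    by (rule Ck_on_cong[OF assms(1), rotated]) (simp add: der)
  then show ?case using Suc.prems by simp
qed

lemma Ck_on_bounded_linear:
  assumes "open S" "bounded_linear L" "Ck_on k S f"
  shows "Ck_on k S (\<lambda>x. L (f x))"
  using assms(3)
proof (induction k arbitrary: f)
  case 0
  then show ?case using assms(2) by (simp add: bounded_linear.continuous_on)
next
  case (Suc k)
  have der: "frechet_derivative (\<lambda>x. L (f x)) (at x) u = L (frechet_derivative f (at x) u)" if "x \<in> S" for x u
    using Suc.prems that
    by (simp flip: frechet_derivative_at[OF bounded_linear.has_derivative[OF assms(2)
          has_derivative_frechet_derivative]])
  have "(\<lambda>x. L (f x)) differentiable (at x)" if "x \<in> S" for x
    using Suc.prems that bounded_linear.has_derivative[OF assms(2)]
    unfolding differentiable_def Ck_on.simps by blast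
  moreover have "Ck_on k S (\<lambda>x. frechet_derivative (\<lambda>x. L (f x)) (at x) u)" for u
    by (rule Ck_on_cong[OF assms(1) _ Suc.IH[of "\<lambda>x. frechet_derivative f (at x) u"]])
      (use Suc.prems der in auto)
  ultimately show ?case by simp
qed

lemma smooth_on_differentiable: "smooth_on S f \<Longrightarrow> x \<in> S \<Longrightarrow> f differentiable (at x)"
  unfolding smooth_on_def by (metis Ck_on.simps(2))

lemma smooth_on_cong:
  assumes "open S" "\<And>y. y \<in> S \<Longrightarrow> f y = g y" "smooth_on S f"
  shows "smooth_on S g"
  using assms Ck_on_cong unfolding smooth_on_def by blast

lemma smooth_on_const: "smooth_on S (\<lambda>x. c)"
  by (simp add: smooth_on_def Ck_on_const)

lemma smooth_on_add: "open S \<Longrightarrow> smooth_on S f \<Longrightarrow> smooth_on S g \<Longrightarrow> smooth_on S (\<lambda>x. f x + g x)"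
  by (simp add: smooth_on_def Ck_on_add)

lemma smooth_on_scaleR:
  fixes f :: "'e::real_normed_vector \<Rightarrow> real"
  shows "open S \<Longrightarrow> smooth_on S f \<Longrightarrow> smooth_on S g \<Longrightarrow> smooth_on S (\<lambda>x. f x *\<^sub>R g x)"
  by (simp add: smooth_on_def Ck_on_scaleR)

lemma smooth_on_bounded_linear:
  "open S \<Longrightarrow> bounded_linear L \<Longrightarrow> smooth_on S f \<Longrightarrow> smooth_on S (\<lambda>x. L (f x))"
  by (simp add: smooth_on_def Ck_on_bounded_linear)

lemma smooth_on_sum:
  assumes "open S" "\<And>i. i \<in> I \<Longrightarrow> smooth_on S (f i)"
  shows "smooth_on S (\<lambda>x. \<Sum>i\<in>I. f i x)"
  using assms(2)
  by (induction I rule: infinite_finite_induct) (simp_all add: smooth_on_const smooth_on_add assms(1))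

text \<open>
  Smoothness of \<open>A\<close> is assumed for each fixed argument only, as in the definition of differential
  forms. To let the argument vary with the point, expand it in coordinates: \<open>A y (v y)\<close> is then a
  finite sum of products of smooth functions.
\<close>

lemma smooth_on_linear_apply:
  fixes A :: "'e::real_normed_vector \<Rightarrow> 'e \<Rightarrow> 'g::real_normed_vector"
  assumes S: "open S" and B: "finite B" "span B = (UNIV :: 'e set)"
    and lin: "\<And>y. y \<in> S \<Longrightarrow> linear (A y)" and A: "\<And>u. smooth_on S (\<lambda>y. A y u)"
    and v: "smooth_on S v"
  shows "smooth_on S (\<lambda>y. A y (v y))"
proof -
  obtain C and coord :: "'e \<Rightarrow> 'e \<Rightarrow> real" where C: "finite C"
    "\<And>b. b \<in> C \<Longrightarrow> bounded_linear (coord b)" "\<And>x. x = (\<Sum>b\<in>C. coord b x *\<^sub>R b)"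
    by (rule finite_dim_coordinates[OF B]) blast
  have expand: "A y w = (\<Sum>b\<in>C. coord b w *\<^sub>R A y b)" if "y \<in> S" for y w
    by (subst C(3)[of w]) (simp add: linear_sum[OF lin[OF that]] linear_cmul[OF lin[OF that]])
  have "smooth_on S (\<lambda>y. \<Sum>b\<in>C. coord b (v y) *\<^sub>R A y b)"
    by (intro smooth_on_sum[OF S] smooth_on_scaleR[OF S smooth_on_bounded_linear[OF S C(2) v] A])
  then show ?thesis by (rule smooth_on_cong[OF S, rotated]) (simp add: expand)
qed

text \<open>
  The product rule for \<open>y \<mapsto> A y (v y)\<close>, with \<open>A\<close> known only argument by argument; the coordinate
  expansion reduces it to the usual product rule.
\<close>

lemma frechet_derivative_linear_apply:
  fixes A :: "'e::real_normed_vector \<Rightarrow> 'e \<Rightarrow> 'g::real_normed_vector"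
  assumes S: "open S" "x \<in> S" and B: "finite B" "span B = (UNIV :: 'e set)"
    and lin: "\<And>y. y \<in> S \<Longrightarrow> linear (A y)" and A: "\<And>u. (\<lambda>y. A y u) differentiable (at x)"
    and v: "v differentiable (at x)"
  shows "frechet_derivative (\<lambda>y. A y (v y)) (at x) h =
    frechet_derivative (\<lambda>y. A y (v x)) (at x) h + A x (frechet_derivative v (at x) h)"
proof -
  obtain C and coord :: "'e \<Rightarrow> 'e \<Rightarrow> real" where C: "finite C"
    "\<And>b. b \<in> C \<Longrightarrow> bounded_linear (coord b)" "\<And>x. x = (\<Sum>b\<in>C. coord b x *\<^sub>R b)"
    by (rule finite_dim_coordinates[OF B]) blast
  have expand: "A y w = (\<Sum>b\<in>C. coord b w *\<^sub>R A y b)" if "y \<in> S" for y w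
    by (subst C(3)[of w]) (simp add: linear_sum[OF lin[OF that]] linear_cmul[OF lin[OF that]])
  let ?DA = "\<lambda>b. frechet_derivative (\<lambda>y. A y b) (at x)"
  have *: "((\<lambda>y. \<Sum>b\<in>C. coord b (w y) *\<^sub>R A y b) has_derivative
      (\<lambda>h. \<Sum>b\<in>C. coord b (w x) *\<^sub>R ?DA b h + coord b (frechet_derivative w (at x) h) *\<^sub>R A x b)) (at x)"
    if "w differentiable (at x)" for w
    by (intro has_derivative_sum has_derivative_scaleR bounded_linear.has_derivative[OF C(2)]
        has_derivative_frechet_derivative A that)
  \<comment> \<open>Applied to \<open>w = v\<close> and to the constant map \<open>w = v x\<close>, this gives the two derivatives to be compared.\<close>
  have D: "frechet_derivative (\<lambda>y. A y (w y)) (at x) h =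
      (\<Sum>b\<in>C. coord b (w x) *\<^sub>R ?DA b h) + A x (frechet_derivative w (at x) h)"
    if "w differentiable (at x)" for w
  proof -
    have "frechet_derivative (\<lambda>y. A y (w y)) (at x) =
        frechet_derivative (\<lambda>y. \<Sum>b\<in>C. coord b (w y) *\<^sub>R A y b) (at x)"
      by (rule frechet_derivative_cong_open[OF S]) (rule expand)
    also have "\<dots> = (\<lambda>h. \<Sum>b\<in>C. coord b (w x) *\<^sub>R ?DA b h +
        coord b (frechet_derivative w (at x) h) *\<^sub>R A x b)"
      using frechet_derivative_at[OF *[OF that]] by simp
    finally show ?thesis by (simp add: sum.distrib expand[OF S(2), symmetric])
  qed
  show ?thesis
    using D[OF v] D[of "\<lambda>_. v x"] lin[OF S(2)] by (simp add: linear_0)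
qed

section \<open>Alternating multilinear maps\<close>

lemma alternating_linear_mid:
  assumes "alternating_multilinear f"
  shows "linear (\<lambda>u. f (xs @ u # ys))"
proof -
  have "linear (\<lambda>u. f ((xs @ undefined # ys)[length xs := u]))"
    by (rule assms[unfolded alternating_multilinear_def, THEN conjunct1, rule_format]) simp
  then show ?thesis by simp
qed

lemma alternating_adjacent_eq:
  assumes "alternating_multilinear f"
  shows "f (xs @ a # a # ys) = 0"
proof -
  let ?vs = "xs @ a # a # ys"
  have "?vs ! length xs = ?vs ! Suc (length xs)" "Suc (length xs) < length ?vs"
    by (simp_all add: nth_append)
  then show ?thesis using assms lessI unfolding alternating_multilinear_def by blast
qed

lemma alternating_adjacent_swap:
  assumes "alternating_multilinear f"
  shows "f (xs @ a # b # ys) = - f (xs @ b # a # ys)"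
proof -
  note lin1 = alternating_linear_mid[OF assms, of xs]
  have lin2: "linear (\<lambda>u. f (xs @ c # u # ys))" for c
    using alternating_linear_mid[OF assms, of "xs @ [c]" ys] by simp
  have "f (xs @ (a + b) # (a + b) # ys) =
      f (xs @ a # a # ys) + f (xs @ a # b # ys) + f (xs @ b # a # ys) + f (xs @ b # b # ys)"
    by (simp add: linear_add[OF lin1] linear_add[OF lin2])
  then show ?thesis by (simp add: alternating_adjacent_eq[OF assms])
qed

lemma alternating_move_front:
  assumes "alternating_multilinear f"
  shows "f (xs @ u # ys) = (-1) ^ length xs * f (u # xs @ ys)"
proof (induction xs arbitrary: ys rule: rev_induct)
  case (snoc a xs)
  have "f ((xs @ [a]) @ u # ys) = - f (xs @ u # a # ys)"
    using alternating_adjacent_swap[OF assms, of xs a u ys] by simp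
  then show ?case using snoc[of "a # ys"] by simp
qed simp

text \<open>
  This accounts for the sign \<open>(-1)\<^sup>i\<close> in the exterior derivative: the Lie derivative alters a
  vector in place, the exterior derivative moves it to the front.
\<close>

lemma alternating_list_update:
  assumes "alternating_multilinear f" "i < length ws"
  shows "f (ws[i := u]) = (-1) ^ i * f (u # take i ws @ drop (Suc i) ws)"
  using alternating_move_front[OF assms(1), of "take i ws" u "drop (Suc i) ws"] assms(2)
  by (simp add: upd_conv_take_nth_drop min_def)

lemma alternating_multilinear_Cons:
  assumes "alternating_multilinear f"
  shows "alternating_multilinear (\<lambda>vs. f (w # vs))"
  unfolding alternating_multilinear_def
proof (intro conjI allI impI)
  fix vs :: "'a list" and i assume "i < length vs"
  then show "linear (\<lambda>u. f (w # vs[i := u]))"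
    using assms[unfolded alternating_multilinear_def, THEN conjunct1, rule_format,
        of "Suc i" "w # vs"] by simp
next
  fix vs :: "'a list" and i j assume "j < length vs" "i < j" "vs ! i = vs ! j"
  then show "f (w # vs) = 0"
    using assms[unfolded alternating_multilinear_def, THEN conjunct2, rule_format,
        of "Suc j" "w # vs" "Suc i"] by simp
qed

lemma alternating_multilinear_add:
  "alternating_multilinear f \<Longrightarrow> alternating_multilinear g \<Longrightarrow> alternating_multilinear (f + g)"
  by (simp add: alternating_multilinear_def linear_compose_add)

lemma alternating_multilinear_uminus:
  "alternating_multilinear f \<Longrightarrow> alternating_multilinear (- f)"
  by (simp add: alternating_multilinear_def linear_compose_neg)

section \<open>Differential forms and Cartan's formula\<close>

lemma smooth_manifold_finite_span:
  fixes M :: "('a, 'e::real_normed_vector) manifold"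
  assumes "smooth_manifold M"
  obtains B :: "'e set" where "finite B" "span B = UNIV"
  using assms by (auto simp: smooth_manifold_def)

lemma open_chart_image: "smooth_manifold M \<Longrightarrow> c \<in> atlas M \<Longrightarrow> open (chart_image c)"
  by (simp add: smooth_manifold_def)

lemma inj_on_chart:
  assumes "smooth_manifold M" "c \<in> atlas M"
  shows "inj_on (snd c) (fst c)"
proof -
  have "fst c \<subseteq> topspace (mtop M)" using assms unfolding smooth_manifold_def by blast
  then show ?thesis
    using assms homeomorphic_imp_injective_map unfolding smooth_manifold_def
    by (metis topspace_subtopology_subset)
qed

lemma forms_alternating:
  "\<omega> \<in> forms M k \<Longrightarrow> c \<in> atlas M \<Longrightarrow> x \<in> chart_image c \<Longrightarrow> alternating_multilinear (\<omega> c x)"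
  by (simp add: forms_def)

lemma forms_smooth:
  "\<omega> \<in> forms M k \<Longrightarrow> c \<in> atlas M \<Longrightarrow> smooth_on (chart_image c) (\<lambda>x. \<omega> c x vs)"
  by (simp add: forms_def)

lemma forms_differentiable:
  "\<omega> \<in> forms M k \<Longrightarrow> c \<in> atlas M \<Longrightarrow> x \<in> chart_image c \<Longrightarrow> (\<lambda>x. \<omega> c x vs) differentiable (at x)"
  by (metis forms_smooth smooth_on_differentiable)

lemma forms_outside:
  "\<omega> \<in> forms M k \<Longrightarrow> \<not> (c \<in> atlas M \<and> x \<in> chart_image c) \<Longrightarrow> \<omega> c x vs = 0"
  unfolding forms_def by blast

lemma forms_linear_Cons:
  "\<omega> \<in> forms M k \<Longrightarrow> c \<in> atlas M \<Longrightarrow> x \<in> chart_image c \<Longrightarrow> linear (\<lambda>u. \<omega> c x (u # vs))"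
  using alternating_linear_mid[OF forms_alternating, of \<omega> M k c x "[]" vs] by simp

lemma zero_in_forms: "0 \<in> forms M k"
  by (auto simp: forms_def alternating_multilinear_def smooth_on_const local_pullback_def fun_eq_iff
      linear_iff)

lemma forms_add:
  assumes M: "smooth_manifold M" and "\<omega> \<in> forms M k" "\<eta> \<in> forms M k"
  shows "\<omega> + \<eta> \<in> forms M k"
  unfolding forms_def mem_Collect_eq
proof (intro conjI allI ballI impI)
  fix c x vs assume "(\<omega> + \<eta>) c x vs \<noteq> 0"
  then have "\<omega> c x vs \<noteq> 0 \<or> \<eta> c x vs \<noteq> 0" by auto
  then show "c \<in> atlas M" "x \<in> chart_image c" "int (length vs) = k"
    using assms(2,3) unfolding forms_def by blast+
next
  fix c x assume "c \<in> atlas M" "x \<in> chart_image c"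
  then show "alternating_multilinear ((\<omega> + \<eta>) c x)"
    using alternating_multilinear_add assms(2,3) forms_alternating by (metis plus_fun_apply)
next
  fix c and vs :: "'b list" assume "c \<in> atlas M"
  then show "smooth_on (chart_image c) (\<lambda>x. (\<omega> + \<eta>) c x vs)"
    using smooth_on_add[OF open_chart_image[OF M] forms_smooth[OF assms(2)] forms_smooth[OF assms(3)]]
    by simp
next
  fix c c' x assume "c \<in> atlas M" "c' \<in> atlas M" "x \<in> local_dom id c c'"
  then have "\<omega> c x = local_pullback (local_rep id c c') (\<omega> c') x"
    "\<eta> c x = local_pullback (local_rep id c c') (\<eta> c') x"
    using assms(2,3) unfolding forms_def by blast+
  then show "(\<omega> + \<eta>) c x = local_pullback (local_rep id c c') ((\<omega> + \<eta>) c') x"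
    by (simp add: local_pullback_def fun_eq_iff)
qed

lemma forms_uminus:
  assumes M: "smooth_manifold M" and "\<omega> \<in> forms M k"
  shows "- \<omega> \<in> forms M k"
  unfolding forms_def mem_Collect_eq
proof (intro conjI allI ballI impI)
  fix c x vs assume "(- \<omega>) c x vs \<noteq> 0"
  then have "\<omega> c x vs \<noteq> 0" by auto
  then show "c \<in> atlas M" "x \<in> chart_image c" "int (length vs) = k"
    using assms(2) unfolding forms_def by blast+
next
  fix c x assume "c \<in> atlas M" "x \<in> chart_image c"
  then show "alternating_multilinear ((- \<omega>) c x)"
    using alternating_multilinear_uminus assms(2) forms_alternating by (metis uminus_apply)
next
  fix c and vs :: "'b list" assume "c \<in> atlas M"
  then show "smooth_on (chart_image c) (\<lambda>x. (- \<omega>) c x vs)"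
    using smooth_on_bounded_linear[OF open_chart_image[OF M] bounded_linear_minus[OF bounded_linear_ident]
        forms_smooth[OF assms(2)]]
    by simp
next
  fix c c' x assume "c \<in> atlas M" "c' \<in> atlas M" "x \<in> local_dom id c c'"
  then have "\<omega> c x = local_pullback (local_rep id c c') (\<omega> c') x"
    using assms(2) unfolding forms_def by blast
  then show "(- \<omega>) c x = local_pullback (local_rep id c c') ((- \<omega>) c') x"
    by (simp add: local_pullback_def fun_eq_iff)
qed

text \<open>
  Smoothness is the point that needs the finite dimension of the model space: the contracted
  argument varies with the point.
\<close>

lemma contraction_in_forms:
  assumes M: "smooth_manifold M" and v: "v \<in> vector_fields M" and \<omega>: "\<omega> \<in> forms M k"
  shows "contraction v \<omega> \<in> forms M (k - 1)"
  unfolding forms_def mem_Collect_eq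
proof (intro conjI allI ballI impI)
  fix c x vs assume "contraction v \<omega> c x vs \<noteq> 0"
  then have *: "\<omega> c x (v c x # vs) \<noteq> 0" by (simp add: contraction_def)
  show "c \<in> atlas M" "x \<in> chart_image c" using * \<omega> forms_outside by blast+
  have "int (length (v c x # vs)) = k" using * \<omega> unfolding forms_def by blast
  then show "int (length vs) = k - 1" by simp
next
  fix c x assume "c \<in> atlas M" "x \<in> chart_image c"
  then show "alternating_multilinear (contraction v \<omega> c x)"
    using alternating_multilinear_Cons[OF forms_alternating[OF \<omega>]]
    by (simp add: contraction_def[abs_def])
next
  fix c and vs :: "'b list" assume c: "c \<in> atlas M"
  obtain B :: "'b set" where B: "finite B" "span B = UNIV"
    using smooth_manifold_finite_span[OF M] by blast
  have "smooth_on (chart_image c) (v c)" using v c by (simp add: vector_fields_def)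
  then show "smooth_on (chart_image c) (\<lambda>x. contraction v \<omega> c x vs)"
    using smooth_on_linear_apply[OF open_chart_image[OF M c] B, of "\<lambda>x u. \<omega> c x (u # vs)" "v c"]
    by (simp add: contraction_def forms_linear_Cons[OF \<omega> c] forms_smooth[OF \<omega> c])
next
  fix c c' x assume "c \<in> atlas M" "c' \<in> atlas M" "x \<in> local_dom id c c'"
  then have "\<omega> c x = local_pullback (local_rep id c c') (\<omega> c') x"
    "v c' (local_rep id c c' x) = frechet_derivative (local_rep id c c') (at x) (v c x)"
    using \<omega> v unfolding forms_def vector_fields_def by blast+
  then show "contraction v \<omega> c x = local_pullback (local_rep id c c') (contraction v \<omega> c') x"
    by (simp add: local_pullback_def contraction_def fun_eq_iff)
qed

lemma contraction_uminus: "contraction v (- \<omega>) = - contraction v \<omega>"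
  by (simp add: contraction_def fun_eq_iff)

lemma contraction_contraction:
  assumes "\<omega> \<in> forms M k"
  shows "contraction v (contraction w \<omega>) = - contraction w (contraction v \<omega>)"
proof (intro ext)
  fix c x vs
  show "contraction v (contraction w \<omega>) c x vs = (- contraction w (contraction v \<omega>)) c x vs"
  proof (cases "c \<in> atlas M \<and> x \<in> chart_image c")
    case True
    then show ?thesis
      using alternating_adjacent_swap[OF forms_alternating[OF assms], of c x "[]" "w c x" "v c x" vs]
      by (simp add: contraction_def)
  next
    case False
    then show ?thesis using forms_outside[OF assms] by (simp add: contraction_def)
  qed
qed

lemma ext_deriv_add:
  assumes "\<omega> \<in> forms M k" "\<eta> \<in> forms M l"
  shows "ext_deriv M (\<omega> + \<eta>) = ext_deriv M \<omega> + ext_deriv M \<eta>"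
proof (intro ext)
  fix c x vs
  have "frechet_derivative (\<lambda>y. \<omega> c y us + \<eta> c y us) (at x) u =
      frechet_derivative (\<lambda>y. \<omega> c y us) (at x) u + frechet_derivative (\<lambda>y. \<eta> c y us) (at x) u"
    if "c \<in> atlas M" "x \<in> chart_image c" for us u
    by (simp flip: frechet_derivative_at[OF has_derivative_add[OF
          has_derivative_frechet_derivative[OF forms_differentiable[OF assms(1) that]]
          has_derivative_frechet_derivative[OF forms_differentiable[OF assms(2) that]]]])
  then show "ext_deriv M (\<omega> + \<eta>) c x vs = (ext_deriv M \<omega> + ext_deriv M \<eta>) c x vs"
    by (simp add: ext_deriv_def sum.distrib distrib_left)
qed

lemma ext_deriv_uminus:
  assumes "\<omega> \<in> forms M k"
  shows "ext_deriv M (- \<omega>) = - ext_deriv M \<omega>"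
proof (intro ext)
  fix c x vs
  have "frechet_derivative (\<lambda>y. - \<omega> c y us) (at x) u = - frechet_derivative (\<lambda>y. \<omega> c y us) (at x) u"
    if "c \<in> atlas M" "x \<in> chart_image c" for us u
    by (simp flip: frechet_derivative_at[OF has_derivative_minus[OF
          has_derivative_frechet_derivative[OF forms_differentiable[OF assms(1) that]]]])
  then show "ext_deriv M (- \<omega>) c x vs = (- ext_deriv M \<omega>) c x vs"
    by (simp add: ext_deriv_def sum_negf)
qed

text \<open>
  Computed in a chart. By the product rule, \<open>d (\<iota>\<^sub>v \<omega>)\<close> has one sum of terms differentiating \<open>\<omega>\<close> and
  one differentiating \<open>v\<close>. The former cancel all terms of \<open>\<iota>\<^sub>v (d \<omega>)\<close> except the derivative of \<open>\<omega>\<close>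
  along \<open>v\<close>; the latter become the sum in the Lie derivative once the vectors \<open>Dv \<cdot> w\<^sub>i\<close> are moved
  back from the front to position \<open>i\<close>.
\<close>

lemma lie_deriv_cartan:
  assumes M: "smooth_manifold M" and v: "v \<in> vector_fields M" and \<omega>: "\<omega> \<in> forms M k"
  shows "lie_deriv M v \<omega> = ext_deriv M (contraction v \<omega>) + contraction v (ext_deriv M \<omega>)"
proof (intro ext)
  fix c x ws
  show "lie_deriv M v \<omega> c x ws =
    (ext_deriv M (contraction v \<omega>) + contraction v (ext_deriv M \<omega>)) c x ws"
  proof (cases "c \<in> atlas M \<and> x \<in> chart_image c")
    case True
    then have c: "c \<in> atlas M" and x: "x \<in> chart_image c" by simp_all
    obtain B :: "'b set" where B: "finite B" "span B = UNIV"
      using smooth_manifold_finite_span[OF M] by blast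
    have vd: "v c differentiable (at x)"
      using v c x by (auto simp: vector_fields_def intro: smooth_on_differentiable)
    define Dv where "Dv = frechet_derivative (v c) (at x)"
    define rest where "rest i = take i ws @ drop (Suc i) ws" for i
    \<comment> \<open>These terms, in which \<open>v\<close> is kept at its value at \<open>x\<close>, occur with opposite signs in both summands.\<close>
    define T where "T i = frechet_derivative (\<lambda>y. \<omega> c y (v c x # rest i)) (at x) (ws ! i)" for i
    have prod: "frechet_derivative (\<lambda>y. \<omega> c y (v c y # us)) (at x) h =
        frechet_derivative (\<lambda>y. \<omega> c y (v c x # us)) (at x) h + \<omega> c x (Dv h # us)" for us h
      unfolding Dv_def
      by (rule frechet_derivative_linear_apply[OF open_chart_image[OF M c] x B,
            of "\<lambda>y u. \<omega> c y (u # us)"])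
        (simp_all add: forms_linear_Cons[OF \<omega> c] forms_differentiable[OF \<omega> c x] vd)
    have d\<iota>: "ext_deriv M (contraction v \<omega>) c x ws =
        (\<Sum>i<length ws. (-1) ^ i * T i) + (\<Sum>i<length ws. (-1) ^ i * \<omega> c x (Dv (ws ! i) # rest i))"
      using c x by (simp add: ext_deriv_def contraction_def prod T_def rest_def
          distrib_left sum.distrib)
    have \<iota>d: "contraction v (ext_deriv M \<omega>) c x ws =
        frechet_derivative (\<lambda>y. \<omega> c y ws) (at x) (v c x) - (\<Sum>i<length ws. (-1) ^ i * T i)"
      using c x by (simp add: ext_deriv_def contraction_def T_def rest_def
          sum.lessThan_Suc_shift sum_negf del: sum.lessThan_Suc)
    have "(\<Sum>i<length ws. \<omega> c x (ws[i := Dv (ws ! i)])) =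
        (\<Sum>i<length ws. (-1) ^ i * \<omega> c x (Dv (ws ! i) # rest i))"
      by (intro sum.cong refl)
        (simp add: alternating_list_update[OF forms_alternating[OF \<omega> c x]] rest_def)
    then show ?thesis using c x by (simp add: lie_deriv_def d\<iota> \<iota>d flip: Dv_def)
  next
    case False
    then show ?thesis by (auto simp: lie_deriv_def ext_deriv_def contraction_def)
  qed
qed

section \<open>Relative forms\<close>

lemma pullback_add: "pullback M N F (\<alpha> + \<beta>) = pullback M N F \<alpha> + pullback M N F \<beta>"
  by (intro ext) (simp add: pullback_def Let_def local_pullback_def)

text \<open>
  Holds pointwise: \<open>v\<^sub>N\<close> at the image point is the image of \<open>v\<^sub>M\<close> under the derivative of \<open>F\<close>. This
  is where \<open>F\<close>-relatedness enters.
\<close>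

lemma pullback_contraction:
  assumes M: "smooth_manifold M" and N: "smooth_manifold N" and F: "smooth_map M N F"
    and v: "F_pair M N F (v\<^sub>N, v\<^sub>M)"
  shows "pullback M N F (contraction v\<^sub>N \<alpha>) = contraction v\<^sub>M (pullback M N F \<alpha>)"
proof (intro ext)
  fix c x vs
  show "pullback M N F (contraction v\<^sub>N \<alpha>) c x vs = contraction v\<^sub>M (pullback M N F \<alpha>) c x vs"
  \<comment> \<open>The pullback selects some chart of \<open>N\<close> around \<open>F p\<close>; one exists since \<open>F\<close> maps into \<open>N\<close>.\<close>
  proof (cases "c \<in> atlas M \<and> x \<in> chart_image c")
    case True
    then have c: "c \<in> atlas M" by simp
    from True obtain p where p: "p \<in> fst c" "x = snd c p" by (auto simp: chart_image_def)
    have inv: "chart_inv c x = p"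
      unfolding chart_inv_def p(2) by (rule inv_into_f_f[OF inj_on_chart[OF M c] p(1)])
    have "p \<in> topspace (mtop M)" using M c p(1) unfolding smooth_manifold_def by blast
    then have "F p \<in> topspace (mtop N)"
      using F by (auto simp: smooth_map_def continuous_map_def)
    then have ex: "\<exists>c'. c' \<in> atlas N \<and> F (chart_inv c x) \<in> fst c'"
      using N inv unfolding smooth_manifold_def by blast
    define c' where "c' = (SOME c'. c' \<in> atlas N \<and> F (chart_inv c x) \<in> fst c')"
    have c': "c' \<in> atlas N" "F p \<in> fst c'"
      using someI_ex[OF ex] inv unfolding c'_def by auto
    have "x \<in> local_dom F c c'" using p c'(2) by (auto simp: local_dom_def)
    then have "frechet_derivative (local_rep F c c') (at x) (v\<^sub>M c x) = v\<^sub>N c' (local_rep F c c' x)"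
      using v c c'(1) by (simp add: F_pair_def)
    then show ?thesis using True
      by (simp add: pullback_def contraction_def local_pullback_def flip: c'_def)
  next
    case False
    then show ?thesis by (auto simp: pullback_def contraction_def)
  qed
qed

lemma rel_contraction_in_rel_forms:
  assumes "smooth_manifold M" "smooth_manifold N" "F_pair M N F v" "\<eta> \<in> rel_forms M N k"
  shows "rel_contraction v \<eta> \<in> rel_forms M N (k - 1)"
  using assms contraction_in_forms[OF assms(1), of _ _ "k - 1"]
  by (auto simp: F_pair_def rel_forms_def rel_contraction_def
      intro: contraction_in_forms forms_uminus)

lemma rel_contraction_uminus: "rel_contraction v (- \<eta>) = - rel_contraction v \<eta>"
  by (cases v; cases \<eta>) (simp add: rel_contraction_def contraction_uminus)

text \<open>
  The sign in \<open>\<iota>\<^sub>v (\<alpha>, \<beta>) = (\<iota>\<^sub>v \<alpha>, - \<iota>\<^sub>v \<beta>)\<close> cancels in a double contraction, so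
  anticommutativity is inherited from both components.
\<close>

lemma rel_contraction_rel_contraction:
  assumes "\<eta> \<in> rel_forms M N k"
  shows "rel_contraction v (rel_contraction w \<eta>) = - rel_contraction w (rel_contraction v \<eta>)"
proof -
  obtain \<alpha> \<beta> where \<eta>: "\<eta> = (\<alpha>, \<beta>)" "\<alpha> \<in> forms N k" "\<beta> \<in> forms M (k - 1)"
    using assms by (auto simp: rel_forms_def)
  obtain v\<^sub>N v\<^sub>M w\<^sub>N w\<^sub>M where vw: "v = (v\<^sub>N, v\<^sub>M)" "w = (w\<^sub>N, w\<^sub>M)" by fastforce
  show ?thesis
    using contraction_contraction[OF \<eta>(2), of v\<^sub>N w\<^sub>N] contraction_contraction[OF \<eta>(3), of v\<^sub>M w\<^sub>M]
    by (simp add: \<eta>(1) vw rel_contraction_def contraction_uminus)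
qed

lemma rel_forms_add:
  assumes "smooth_manifold M" "smooth_manifold N" "\<eta> \<in> rel_forms M N k" "\<theta> \<in> rel_forms M N k"
  shows "\<eta> + \<theta> \<in> rel_forms M N k"
  using assms by (auto simp: rel_forms_def intro: forms_add)

lemma rel_d_add:
  assumes "\<eta> \<in> rel_forms M N k" "\<theta> \<in> rel_forms M N l"
  shows "rel_d M N F (\<eta> + \<theta>) = rel_d M N F \<eta> + rel_d M N F \<theta>"
  using assms by (auto simp: rel_forms_def rel_d_def ext_deriv_add pullback_add algebra_simps)

text \<open>
  In the first component this is Cartan's formula on \<open>N\<close>. In the second, the terms without pullback
  give Cartan's formula on \<open>M\<close> thanks to the two minus signs, and the remaining ones are
  \<open>F\<^sup>* (\<iota>\<^sub>v \<alpha>) - \<iota>\<^sub>v (F\<^sup>* \<alpha>)\<close>, which vanishes for an \<open>F\<close>-pair.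
\<close>

lemma rel_lie_cartan:
  assumes M: "smooth_manifold M" and N: "smooth_manifold N" and F: "smooth_map M N F"
    and v: "F_pair M N F v" and \<eta>: "\<eta> \<in> rel_forms M N k"
  shows "rel_lie M N v \<eta> = rel_d M N F (rel_contraction v \<eta>) + rel_contraction v (rel_d M N F \<eta>)"
proof -
  obtain \<alpha> \<beta> where \<eta>': "\<eta> = (\<alpha>, \<beta>)" "\<alpha> \<in> forms N k" "\<beta> \<in> forms M (k - 1)"
    using \<eta> by (auto simp: rel_forms_def)
  obtain v\<^sub>N v\<^sub>M where v': "v = (v\<^sub>N, v\<^sub>M)" by fastforce
  have vf: "v\<^sub>N \<in> vector_fields N" "v\<^sub>M \<in> vector_fields M"
    using v by (simp_all add: F_pair_def v')
  have "contraction v\<^sub>M (pullback M N F \<alpha> - ext_deriv M \<beta>) =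
      contraction v\<^sub>M (pullback M N F \<alpha>) - contraction v\<^sub>M (ext_deriv M \<beta>)"
    by (simp add: contraction_def fun_eq_iff)
  then show ?thesis
    using pullback_contraction[OF M N F v[unfolded v'], of \<alpha>]
      lie_deriv_cartan[OF N vf(1) \<eta>'(2)] lie_deriv_cartan[OF M vf(2) \<eta>'(3)]
      ext_deriv_uminus[OF contraction_in_forms[OF M vf(2) \<eta>'(3)]]
    by (simp add: \<eta>'(1) v' rel_lie_def rel_d_def rel_contraction_def)
qed

lemma rel_exact_zero:
  assumes "smooth_manifold M" "smooth_manifold N"
  shows "rel_exact M N F k 0"
proof -
  have z: "(0 :: ('a, 'b, 'c, 'd) rel_form) \<in> rel_forms M N (k - 1)"
    by (simp add: rel_forms_def zero_prod_def zero_in_forms)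
  have "rel_d M N F 0 = 0" using rel_d_add[OF z z, of F] by simp
  then show ?thesis using z unfolding rel_exact_def by metis
qed

theorem theorem6p2:
  fixes M :: "('a, 'e::real_normed_vector) manifold"
    and N :: "('b, 'f::real_normed_vector) manifold"
    and F :: "'a \<Rightarrow> 'b"
    and n :: nat
    and \<omega> \<sigma> f\<^sub>1x :: "('a, 'e, 'b, 'f) rel_form"
    and v\<^sub>\<sigma> v\<^sub>x :: "('a, 'e, 'b, 'f) vf_pair"
  assumes "n \<ge> 1"
    and "smooth_manifold M" and "smooth_manifold N" and "smooth_map M N F"
    and "\<omega> \<in> rel_forms M N (int n + 1)" and "rel_d M N F \<omega> = 0"
    and "\<sigma> \<in> rel_forms M N (int n - 1)"
    and "F_pair M N F v\<^sub>\<sigma>" and "rel_d M N F \<sigma> = - rel_contraction v\<^sub>\<sigma> \<omega>"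
    and "F_pair M N F v\<^sub>x" and "rel_lie M N v\<^sub>x \<omega> = 0"
    and "f\<^sub>1x \<in> rel_forms M N (int n - 1)" and "rel_d M N F f\<^sub>1x = - rel_contraction v\<^sub>x \<omega>"
    and "rel_lie M N v\<^sub>x \<sigma> = 0"
  shows "rel_lie M N v\<^sub>\<sigma> f\<^sub>1x = rel_d M N F (rel_contraction v\<^sub>\<sigma> f\<^sub>1x + rel_contraction v\<^sub>x \<sigma>)
    \<and> rel_exact M N F (int n - 1) (rel_lie M N v\<^sub>\<sigma> f\<^sub>1x)
    \<and> rel_exact M N F (int n - 1) (rel_lie M N v\<^sub>x \<sigma>)"
proof -
  note mfd = \<open>smooth_manifold M\<close> \<open>smooth_manifold N\<close>
  note cartan = rel_lie_cartan[OF mfd \<open>smooth_map M N F\<close>]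
  let ?d = "rel_d M N F"
  let ?\<theta> = "rel_contraction v\<^sub>\<sigma> f\<^sub>1x + rel_contraction v\<^sub>x \<sigma>"
  have \<iota>f: "rel_contraction v\<^sub>\<sigma> f\<^sub>1x \<in> rel_forms M N (int n - 1 - 1)"
    and \<iota>\<sigma>: "rel_contraction v\<^sub>x \<sigma> \<in> rel_forms M N (int n - 1 - 1)"
    by (fact rel_contraction_in_rel_forms[OF mfd assms(8,12)]
        rel_contraction_in_rel_forms[OF mfd assms(10,7)])+
  have "rel_contraction v\<^sub>\<sigma> (?d f\<^sub>1x) = - rel_contraction v\<^sub>x (?d \<sigma>)"
    using rel_contraction_rel_contraction[OF assms(5), of v\<^sub>\<sigma> v\<^sub>x]
    by (simp add: assms(9,13) rel_contraction_uminus)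
  also have "\<dots> = ?d (rel_contraction v\<^sub>x \<sigma>)"
    using cartan[OF assms(10,7)] assms(14) by (intro minus_unique) (simp add: add.commute)
  finally have eq: "rel_lie M N v\<^sub>\<sigma> f\<^sub>1x = ?d ?\<theta>"
    using cartan[OF assms(8,12)] rel_d_add[OF \<iota>f \<iota>\<sigma>] by simp
  moreover have "?\<theta> \<in> rel_forms M N (int n - 1 - 1)"
    using rel_forms_add[OF mfd \<iota>f \<iota>\<sigma>] .
  ultimately have "rel_exact M N F (int n - 1) (rel_lie M N v\<^sub>\<sigma> f\<^sub>1x)"
    unfolding rel_exact_def by blast
  with eq show ?thesis using rel_exact_zero[OF mfd] assms(14) by metis
qed

end
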